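(* Let $\alpha>0$ and $r$ be real numbers, let $d\ge 1$ and $p\ge 1$ be integers, put $N=p+d$ and $\lambda=rd/\alpha$, and let $f$ be a sufficiently smooth function on $\mathbb{R}$ such that the fractional derivatives $D_{x\mp}^{\alpha}f(x)$ are defined. For a Grünwald type approximation of $D_{x\mp}^{\alpha}f(x)$ of order $p$ and shift $r$ with generator of the form $$W(z)=\left(\beta_0+\beta_1 z+\cdots+\beta_{N-1}z^{N-1}\right)^{\alpha/d},$$ the coefficients $\beta_j$ are given by $$\beta_j=\frac{N_j}{D_j},\qquad j=0,1,\dots,N-1,$$ where $$N_j=\sum_{\substack{0\le m_1<m_2<\cdots<m_{p-1}\le N-1\\ m_i\ne j,\ 1\le i\le p-1}}\ \prod_{k=1}^{p-1}(\lambda-m_k),\qquad D_j=\frac{(-1)^d}{d!}\prod_{\substack{m=0\\ m\ne j}}^{N-1}(j-m)$$ (for $p=1$, $N_j=1$). Moreover, the leading and some successive error coefficients $R_m$ of the approximation, where $R_m$ is the coefficient attached to $h^{m-d}D_{x\mp}^{\alpha+m-d}f(x)$, are given by $$R_m=\frac{\alpha}{m!\,d}\sum_{j=0}^{N-1}(\lambda-j)^m\beta_j,\qquad m=N,N+1,\dots,N+p.$$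
   Context: Fractional derivatives. For $\alpha>0$ and $n=[\alpha]+1$ ($[\cdot]$ the integer part), the left ($-$) and right ($+$) Riemann–Liouville derivatives are $$D_{x-}^{\alpha}f(x)=\frac{1}{\Gamma(n-\alpha)}\frac{d^n}{dx^n}\int_{-\infty}^{x}\frac{f(\eta)}{(x-\eta)^{\alpha+1-n}}\,d\eta,\qquad D_{x+}^{\alpha}f(x)=\frac{(-1)^n}{\Gamma(n-\alpha)}\frac{d^n}{dx^n}\int_{x}^{\infty}\frac{f(\eta)}{(\eta-x)^{\alpha+1-n}}\,d\eta.$$ Grünwald type approximation. Let $W(z)=\sum_{k\ge0}w_kz^k$ be a generating function with real coefficients (here, the power series expansion at $0$ of the given power of a polynomial). For $h>0$ and shift $r$ set $$\Delta_{\pm h,p,r}^{\alpha}f(x)=\frac{1}{h^{\alpha}}\sum_{k=0}^{\infty}w_k\,f\big(x\mp(k-r)h\big).$$ $W$ approximates $D_{x\mp}^{\alpha}$ with order $p$ and shift $r$ (a Grünwald type approximation of order $p$ with shift $r$) if $\Delta_{\pm h,p,r}^{\alpha}f(x)=D_{x\mp}^{\alpha}f(x)+O(h^p)$ as $h\to0$, for sufficiently smooth $f$. "Sufficiently smooth" may be taken to mean: $f\in C^{M+n+1}(\mathbb{R})$ with $f^{(k)}\in L_1(\mathbb{R})$ for $0\le k\le M+n+1$, for a sufficiently large integer $M\ge 2p$. Known characterization (from prior work): for such $f$, $W$ approximates $D_{x\mp}^{\alpha}$ with order $p$ and shift $r$ if and only if $$G(z):=\frac{1}{z^{\alpha}}W(e^{-z})e^{rz}=1+O(z^p)\quad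 (z\to0).$$ Error coefficients. Writing $G(z)=1+\sum_{l\ge p}a_lz^l$, one has $\Delta_{\pm h,p,r}^{\alpha}f(x)=D_{x\mp}^{\alpha}f(x)+\sum_{l=p}^{M}h^{l}a_lD_{x\mp}^{\alpha+l}f(x)+O(h^{M+1})$. The numbers $a_l$ are the error coefficients of the approximation, and $R_m=a_{m-d}$.
   Formalization: Assumes the polynomial is positive just left of 1 (for even α/d its sign is otherwise undetermined), and at m=N+p adds ((α−d)/(2α))R_N² to the R_m formula, which is false as printed (α=2, d=p=1, r=0: R_3=7/12, not 1/3). *)

theory Defs
  imports "HOL-Analysis.Analysis" "HOL-Library.Landau_Symbols"
begin

definition smooth_L1 :: "nat \<Rightarrow> (real \<Rightarrow> real) \<Rightarrow> bool" where
  "smooth_L1 K f \<longleftrightarrow>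
     (\<forall>k<K. (deriv ^^ k) f differentiable_on UNIV) \<and>
     (\<forall>k\<le>K. continuous_on UNIV ((deriv ^^ k) f) \<and> integrable lborel ((deriv ^^ k) f))"

definition frac_ord :: "real \<Rightarrow> nat" where
  "frac_ord \<alpha> = nat \<lfloor>\<alpha>\<rfloor> + 1"

definition RL_left :: "real \<Rightarrow> (real \<Rightarrow> real) \<Rightarrow> real \<Rightarrow> real" where
  "RL_left \<alpha> f x =
     (let n = frac_ord \<alpha> in
        1 / Gamma (real n - \<alpha>) *
        (deriv ^^ n) (\<lambda>y. LBINT \<eta>:{..y}. f \<eta> / (y - \<eta>) powr (\<alpha> + 1 - real n)) x)"

definition RL_right :: "real \<Rightarrow> (real \<Rightarrow> real) \<Rightarrow> real \<Rightarrow> real" where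
  "RL_right \<alpha> f x =
     (let n = frac_ord \<alpha> in
        (- 1) ^ n / Gamma (real n - \<alpha>) *
        (deriv ^^ n) (\<lambda>y. LBINT \<eta>:{y..}. f \<eta> / (\<eta> - y) powr (\<alpha> + 1 - real n)) x)"

datatype side = Left_side | Right_side

fun RL_deriv :: "side \<Rightarrow> real \<Rightarrow> (real \<Rightarrow> real) \<Rightarrow> real \<Rightarrow> real" where
  "RL_deriv Left_side \<alpha> f x = RL_left \<alpha> f x"
| "RL_deriv Right_side \<alpha> f x = RL_right \<alpha> f x"

text \<open>
  The left derivative is approximated with the nodes \<open>x - (k - r) h\<close>, the right one with
  \<open>x + (k - r) h\<close>.
\<close>

fun G_node :: "side \<Rightarrow> real \<Rightarrow> real \<Rightarrow> real \<Rightarrow> nat \<Rightarrow> real" where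
  "G_node Left_side r h x k = x - (real k - r) * h"
| "G_node Right_side r h x k = x + (real k - r) * h"

definition G_diff ::
    "side \<Rightarrow> (nat \<Rightarrow> real) \<Rightarrow> real \<Rightarrow> real \<Rightarrow> real \<Rightarrow> (real \<Rightarrow> real) \<Rightarrow> real \<Rightarrow> real" where
  "G_diff s w \<alpha> r h f x = 1 / h powr \<alpha> * (\<Sum>k. w k * f (G_node s r h x k))"

text \<open>
  The smoothness index \<open>M\<close> is only required to be some number \<open>\<ge> 2 p\<close>
  (``sufficiently smooth'').  Since \<open>suminf\<close> is total, convergence of the series in the
  difference operator is demanded explicitly, for small \<open>h\<close> only.
\<close>

definition G_approximates ::
    "side \<Rightarrow> (nat \<Rightarrow> real) \<Rightarrow> real \<Rightarrow> nat \<Rightarrow> real \<Rightarrow> bool" where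
  "G_approximates s w \<alpha> p r \<longleftrightarrow>
     (\<exists>M\<ge>2 * p. \<forall>f. smooth_L1 (M + frac_ord \<alpha> + 1) f \<longrightarrow>
        (\<forall>x. (\<forall>\<^sub>F h in at_right 0. summable (\<lambda>k. w k * f (G_node s r h x k))) \<and>
             (\<lambda>h. G_diff s w \<alpha> r h f x - RL_deriv s \<alpha> f x) \<in> O[at_right 0](\<lambda>h. h ^ p)))"

text \<open>
  The power is the principal one.  The identity is required near \<open>0\<close> only, so \<open>w\<close> is the
  sequence of Taylor coefficients at \<open>0\<close> of the power of the polynomial with coefficients
  \<open>\<beta> 0, \<dots>, \<beta> (N - 1)\<close>.
\<close>

definition poly_power_coeffs ::
    "(nat \<Rightarrow> real) \<Rightarrow> nat \<Rightarrow> (nat \<Rightarrow> real) \<Rightarrow> real \<Rightarrow> bool" where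
  "poly_power_coeffs w N \<beta> c \<longleftrightarrow>
     (\<forall>\<^sub>F z in nhds (0::complex).
        (\<lambda>k. complex_of_real (w k) * z ^ k) sums
          ((\<Sum>j<N. complex_of_real (\<beta> j) * z ^ j) powr complex_of_real c))"

definition G_symbol :: "(nat \<Rightarrow> real) \<Rightarrow> real \<Rightarrow> real \<Rightarrow> real \<Rightarrow> real" where
  "G_symbol w \<alpha> r z = 1 / z powr \<alpha> * (\<Sum>k. w k * exp (- z) ^ k) * exp (r * z)"

text \<open>
  The coefficients of the expansion of the symbol as a power series
  \<open>1 + a p * z ^ p + a (p + 1) * z ^ (p + 1) + \<dots>\<close>; a one-sided neighbourhood of \<open>0\<close>
  determines them.
\<close>

definition symbol_expansion ::
    "(nat \<Rightarrow> real) \<Rightarrow> real \<Rightarrow> nat \<Rightarrow> real \<Rightarrow> (nat \<Rightarrow> real) \<Rightarrow> bool" where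
  "symbol_expansion w \<alpha> p r a \<longleftrightarrow>
     (\<forall>\<^sub>F z in at_right 0. (\<lambda>i. a (p + i) * z ^ (p + i)) sums (G_symbol w \<alpha> r z - 1))"

definition error_expansion ::
    "side \<Rightarrow> (nat \<Rightarrow> real) \<Rightarrow> real \<Rightarrow> nat \<Rightarrow> real \<Rightarrow> nat \<Rightarrow> (nat \<Rightarrow> real) \<Rightarrow> bool" where
  "error_expansion s w \<alpha> p r M b \<longleftrightarrow>
     (\<forall>f. smooth_L1 (M + frac_ord \<alpha> + 1) f \<longrightarrow>
        (\<forall>x. (\<lambda>h. G_diff s w \<alpha> r h f x - RL_deriv s \<alpha> f x
                   - (\<Sum>l=p..M. h ^ l * b l * RL_deriv s (\<alpha> + real l) f x))
               \<in> O[at_right 0](\<lambda>h. h ^ (M + 1))))"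

definition beta_num :: "real \<Rightarrow> nat \<Rightarrow> nat \<Rightarrow> nat \<Rightarrow> real" where
  "beta_num lam p N j =
     (\<Sum>S | S \<subseteq> {..<N} - {j} \<and> card S = p - 1. \<Prod>m\<in>S. (lam - real m))"

definition beta_den :: "nat \<Rightarrow> nat \<Rightarrow> nat \<Rightarrow> real" where
  "beta_den d N j = (- 1) ^ d / fact d * (\<Prod>m\<in>{..<N} - {j}. (real j - real m))"

definition R_formula :: "real \<Rightarrow> nat \<Rightarrow> real \<Rightarrow> nat \<Rightarrow> (nat \<Rightarrow> real) \<Rightarrow> nat \<Rightarrow> real" where
  "R_formula \<alpha> d lam N \<beta> m =
     \<alpha> / (fact m * real d) * (\<Sum>j<N. (lam - real j) ^ m * \<beta> j)"

end

theory Submission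
  imports Defs "HOL-Complex_Analysis.Conformal_Mappings" "HOL-Complex_Analysis.Laurent_Convergence"
begin

text \<open>
  Applied to a test function that equals $e^{\pm x}$ on the relevant half-line, the difference
  operator becomes multiplication by the symbol $G(h)$ and every fractional derivative becomes
  multiplication by $1$.  So the order of approximation says $G(h) = 1 + O(h^p)$, and
  the error coefficients of any expansion are the Taylor coefficients of $G$.  Both $|W|$ and
  $|P|^{\alpha/d}$, with $P$ the polynomial under the power, continue along the unit disc without the
  zeros of $P$, hence $W = P^{\alpha/d}$ near $1$.  Taking $G$ to the power $d/\alpha$ gives
  $\sum_j \beta_j e^{(\lambda - j) h} = h^d + O(h^N)$, a Vandermonde system for the
  $\beta_j$, which Lagrange interpolation solves.  The error coefficients come from the binomial
  series of $G = (1 + u)^{\alpha/d}$ with $u = O(h^p)$.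
\<close>

section \<open>A test function that is exponential on a half-line\<close>

text \<open>
  The two branches agree at $0$ to order $m$ if $P(x) = e^{2x} + O(x^{m+1})$; the derivative is
  again such a function, for the polynomial $P' - P$.
\<close>

definition exp_glue :: "real poly \<Rightarrow> real \<Rightarrow> real" where
  "exp_glue P x = (if x \<in> {..0} then exp x else exp (- x) * poly P x)"

text \<open>The closed branches meet only at 0. There the values 1 and P(0) and the slopes 1 and
  P'(0) - P(0) must agree, which forces P(0) = 1 and P'(0) = 2.\<close>

lemma exp_glue_has_derivative:
  assumes "coeff P 0 = 1" "coeff P 1 = 2"
  shows "(exp_glue P has_real_derivative exp_glue (pderiv P - P) x) (at x)"
proof -
  have "((\<lambda>x. if x \<in> {..0} then exp x else exp (- x) * poly P x) has_vector_derivative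
      (if x \<in> {..0} then exp x else exp (- x) * poly (pderiv P - P) x)) (at x within UNIV)"
    using assms
    by (intro has_vector_derivative_If_within_closures[where T = "{0<..}"])
       (auto simp: has_real_derivative_iff_has_vector_derivative[symmetric] poly_0_coeff_0 coeff_pderiv
         algebra_simps intro!: derivative_eq_intros)
  then show ?thesis
    by (simp add: has_real_derivative_iff_has_vector_derivative exp_glue_def[abs_def])
qed

lemma exp_glue_continuous:
  assumes "coeff P 0 = 1"
  shows "continuous_on UNIV (exp_glue P)"
proof -
  have "continuous_on ({..0} \<union> {0..}) (\<lambda>x. if x \<in> {..0} then exp x else exp (- x) * poly P x)"
    by (rule continuous_on_If) (use assms in \<open>auto intro!: continuous_intros simp: poly_0_coeff_0\<close>)
  moreover have "{..0} \<union> {0..} = (UNIV :: real set)" by auto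
  ultimately show ?thesis
    by (simp add: exp_glue_def[abs_def])
qed

lemma has_bochner_integral_Gamma:
  fixes s :: real
  assumes "s > 0"
  shows "has_bochner_integral lborel (\<lambda>t. indicator {0..} t * (t powr (s - 1) * exp (- t))) (Gamma s)"
proof (rule has_bochner_integral_nn_integral)
  show "(\<integral>\<^sup>+ t. ennreal (indicator {0..} t * (t powr (s - 1) * exp (- t))) \<partial>lborel) = ennreal (Gamma s)"
    using Gamma_conv_nn_integral_real[OF assms] by (simp add: exp_minus divide_inverse mult_ac)
qed (use assms Gamma_real_pos[of s] in \<open>auto\<close>)

lemma exp_glue_integrable: "integrable lborel (exp_glue P)"
proof -
  have exp_integrable: "integrable lborel (\<lambda>x. indicator {0..} x * (exp (- x) * x ^ k) :: real)" for k
  proof -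
    have "integrable lborel (\<lambda>t::real. indicator {0..} t * (t powr (real (Suc k) - 1) * exp (- t)))"
      using has_bochner_integral_Gamma[of "real (Suc k)"] by (simp add: has_bochner_integral_iff)
    then show ?thesis
    proof (rule integrable_cong_AE_imp)
      \<comment> \<open>For k = 0 equality fails at t = 0, because \<open>0 powr 0 = 0\<close> but
        \<open>0 ^ 0 = 1\<close>.\<close>
      show "AE t in lborel. indicator {0..} t * (t powr (real (Suc k) - 1) * exp (- t)) =
          indicator {0..} t * (exp (- t) * t ^ k)"
        using AE_lborel_singleton[of "0::real"]
        by eventually_elim (auto simp: powr_realpow split: split_indicator)
    qed simp
  qed
  \<comment> \<open>The branch exp x on the negative half-line is the reflection of the case k =
    0.\<close>
  have "integrable lborel (\<lambda>x. indicator {0..} (0 + (- 1) * x) * (exp (- (0 + (- 1) * x)) * (0 + (- 1) * x) ^ 0) :: real)"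
    using exp_integrable by (rule lborel_integrable_real_affine) simp
  moreover have "integrable lborel (\<lambda>x. indicator {0..} x * (exp (- x) * poly P x))"
    unfolding poly_altdef sum_distrib_left
    using exp_integrable by (intro Bochner_Integration.integrable_sum) (simp add: mult.left_commute)
  ultimately have "integrable lborel (\<lambda>x. indicator {0..} (0 + (- 1) * x) * (exp (- (0 + (- 1) * x)) * (0 + (- 1) * x) ^ 0) +
     indicator {0..} x * (exp (- x) * poly P x))"
    by (rule Bochner_Integration.integrable_add)
  then show ?thesis
  proof (rule integrable_cong_AE_imp)
    show "exp_glue P \<in> borel_measurable lborel"
      unfolding exp_glue_def[abs_def] poly_altdef by measurable
    \<comment> \<open>Both indicators count the point 0, a null set.\<close>
    show "AE x in lborel. indicator {0..} (0 + (- 1) * x) * (exp (- (0 + (- 1) * x)) * (0 + (- 1) * x) ^ 0) +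
     indicator {0..} x * (exp (- x) * poly P x) = exp_glue P x"
      using AE_lborel_singleton[of "0::real"]
      by eventually_elim (auto simp: exp_glue_def split: split_indicator)
  qed
qed

text \<open>Each derivative uses up one matching Taylor coefficient, so k derivatives need those up
  to index k. The factor c collects the powers of \<sigma> in the induction.\<close>

lemma higher_deriv_rescale_exp_glue:
  assumes "\<And>i. i \<le> k \<Longrightarrow> coeff P i = 2 ^ i / fact i"
  shows "(deriv ^^ k) (\<lambda>x. c * exp_glue P (\<sigma> * x)) =
      (\<lambda>x. c * \<sigma> ^ k * exp_glue (((\<lambda>Q. pderiv Q - Q) ^^ k) P) (\<sigma> * x))"
  using assms
proof (induction k arbitrary: P c)
  case (Suc k)
  from Suc.prems[of 0] Suc.prems[of 1] have "coeff P 0 = 1" "coeff P 1 = 2" by auto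
  then have "((\<lambda>x. c * exp_glue P (\<sigma> * x)) has_real_derivative c * (exp_glue (pderiv P - P) (\<sigma> * x) * \<sigma>)) (at x)" for x
    by (intro DERIV_cmult DERIV_chain2[OF exp_glue_has_derivative]) (auto intro!: derivative_eq_intros)
  then have 1: "deriv (\<lambda>x. c * exp_glue P (\<sigma> * x)) = (\<lambda>x. c * \<sigma> * exp_glue (pderiv P - P) (\<sigma> * x))"
    by (intro ext DERIV_imp_deriv) (simp add: mult_ac)
  \<comment> \<open>The function e^(2x) is fixed by Q -> Q' - Q: (i+1) 2^(i+1) / (i+1)! - 2^i / i! =
    2^i / i!. Only the top coefficient is lost.\<close>
  have "coeff (pderiv P - P) i = 2 ^ i / fact i" if "i \<le> k" for i
    using Suc.prems[of i] Suc.prems[of "Suc i"] that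
    by (simp add: coeff_pderiv divide_simps) (simp add: algebra_simps)?
  from Suc.IH[OF this, of "c * \<sigma>"] show ?case
    by (simp add: funpow_Suc_right 1 mult.assoc del: funpow.simps)
qed simp

lemma coeff_iterate_pderiv_minus:
  fixes P :: "real poly"
  assumes "\<And>i. i \<le> k + l \<Longrightarrow> coeff P i = 2 ^ i / fact i" "j \<le> l"
  shows "coeff (((\<lambda>Q. pderiv Q - Q) ^^ k) P) j = 2 ^ j / fact j"
  using assms
proof (induction k arbitrary: j l)
  case (Suc k)
  have "coeff (((\<lambda>Q. pderiv Q - Q) ^^ k) P) i = 2 ^ i / fact i" if "i \<le> Suc l" for i
    using that Suc.prems by (intro Suc.IH[of "Suc l"]) auto
  from this[of j] this[of "Suc j"] \<open>j \<le> l\<close> show ?case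
    by (simp add: coeff_pderiv divide_simps) (simp add: algebra_simps)?
qed simp

text \<open>For P take the Taylor polynomial of e^(2x) of degree K. Then the derivatives of order
  below K match at 0 in value and slope, and the one of order K still matches in value. The sign of
  \<sigma> selects the half-line.\<close>

lemma exists_exponential_smooth_L1:
  assumes "\<sigma> \<noteq> 0"
  obtains f where "smooth_L1 K f" "\<And>x. \<sigma> * x \<le> 0 \<Longrightarrow> f x = exp (\<sigma> * x)"
proof
  define P :: "real poly" where "P = (\<Sum>i\<le>K. monom (2 ^ i / fact i) i)"
  define D where "D k = ((\<lambda>Q. pderiv Q - Q) ^^ k) P" for k
  let ?f = "\<lambda>x. exp_glue P (\<sigma> * x)"
  have P: "coeff P i = 2 ^ i / fact i" if "i \<le> K" for i
    using that by (simp add: P_def coeff_sum)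
  have D: "coeff (D k) i = 2 ^ i / fact i" if "k + i \<le> K" for k i
    unfolding D_def by (rule coeff_iterate_pderiv_minus[of _ "K - k"]) (use P that in auto)
  have deriv: "(deriv ^^ k) ?f = (\<lambda>x. \<sigma> ^ k * exp_glue (D k) (\<sigma> * x))" if "k \<le> K" for k
    using higher_deriv_rescale_exp_glue[of k P 1 \<sigma>] P that by (simp add: D_def)
  have cont: "continuous_on UNIV (exp_glue (D k))" if "k \<le> K" for k
    using D[of k 0] that by (auto intro: exp_glue_continuous)
  have diff: "((deriv ^^ k) ?f) differentiable (at x)" if "k < K" for k x
  proof -
    have "coeff (D k) 0 = 1" "coeff (D k) 1 = 2"
      using D[of k 0] D[of k 1] that by auto
    then have "((\<lambda>x. \<sigma> ^ k * exp_glue (D k) (\<sigma> * x)) has_real_derivative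
        \<sigma> ^ k * (exp_glue (pderiv (D k) - D k) (\<sigma> * x) * \<sigma>)) (at x)"
      by (intro DERIV_cmult DERIV_chain2[OF exp_glue_has_derivative]) (auto intro!: derivative_eq_intros)
    then show ?thesis
      using that by (auto simp: deriv real_differentiable_def)
  qed
  show "smooth_L1 K ?f"
    unfolding smooth_L1_def
  proof (intro conjI allI impI)
    fix k assume "k < K"
    then show "(deriv ^^ k) ?f differentiable_on UNIV"
      using diff by (auto simp: differentiable_on_def)
  next
    fix k assume "k \<le> K"
    have "continuous_on UNIV (\<lambda>x. exp_glue (D k) (\<sigma> * x))"
      by (rule continuous_on_compose2[OF cont]) (use \<open>k \<le> K\<close> in \<open>auto intro!: continuous_intros\<close>)
    then show "continuous_on UNIV ((deriv ^^ k) ?f)"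
      using \<open>k \<le> K\<close> by (auto simp: deriv intro!: continuous_intros)
    show "integrable lborel ((deriv ^^ k) ?f)"
      using lborel_integrable_real_affine[OF exp_glue_integrable assms, of "D k" 0] \<open>k \<le> K\<close>
      by (simp add: deriv)
  qed
  show "?f x = exp (\<sigma> * x)" if "\<sigma> * x \<le> 0" for x
    using that by (simp add: exp_glue_def)
qed

section \<open>Fractional derivatives and grid values of the exponential\<close>

lemma higher_deriv_exp:
  fixes c \<sigma> :: real
  shows "(deriv ^^ n) (\<lambda>x. c * exp (\<sigma> * x)) = (\<lambda>x. c * \<sigma> ^ n * exp (\<sigma> * x))"
proof (induction n)
  case (Suc n)
  show ?case
    by (simp add: Suc) (auto intro!: DERIV_imp_deriv derivative_eq_intros)
qed simp

lemma frac_ord_greater: "real (frac_ord \<alpha>) - \<alpha> > 0"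
  unfolding frac_ord_def by linarith

text \<open>The substitution \<eta> = y - \<sigma> t leads to Euler's integral for Gamma(s). With
  \<sigma> = 1 or -1 it covers the left and the right kernel at once; the case of interest is s = n
  - \<alpha>.\<close>

lemma RL_kernel_exp_integral:
  assumes "s > (0::real)" and f: "\<And>t. t \<ge> 0 \<Longrightarrow> f (y - \<sigma> * t) = exp (\<sigma> * y) * exp (- t)" and "\<bar>\<sigma>\<bar> = 1"
  shows "(LBINT \<eta>:{\<eta>. \<sigma> * \<eta> \<le> \<sigma> * y}. f \<eta> / (\<sigma> * (y - \<eta>)) powr (1 - s)) = exp (\<sigma> * y) * Gamma s"
proof -
  have \<sigma>: "\<sigma> * \<sigma> = 1" "\<sigma> \<noteq> 0" using \<open>\<bar>\<sigma>\<bar> = 1\<close> by (auto simp: abs_if split: if_splits)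
  have "(LBINT \<eta>:{\<eta>. \<sigma> * \<eta> \<le> \<sigma> * y}. f \<eta> / (\<sigma> * (y - \<eta>)) powr (1 - s)) =
      (\<integral>\<eta>. indicator {\<eta>. \<sigma> * \<eta> \<le> \<sigma> * y} \<eta> * (f \<eta> / (\<sigma> * (y - \<eta>)) powr (1 - s)) \<partial>lborel)"
    by (simp add: set_lebesgue_integral_def)
  also have "\<dots> = (\<integral>t. indicator {\<eta>. \<sigma> * \<eta> \<le> \<sigma> * y} (y + (- \<sigma>) * t) *
      (f (y + (- \<sigma>) * t) / (\<sigma> * (y - (y + (- \<sigma>) * t))) powr (1 - s)) \<partial>lborel)"
    using \<open>\<bar>\<sigma>\<bar> = 1\<close> \<sigma> by (subst lborel_integral_real_affine[of "- \<sigma>" _ y]) simp_all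
  also have "\<dots> = (\<integral>t. exp (\<sigma> * y) * (indicator {0..} t * (t powr (s - 1) * exp (- t))) \<partial>lborel)"
  proof (intro Bochner_Integration.integral_cong refl)
    fix t :: real
    have "\<sigma> * (y + (- \<sigma>) * t) = \<sigma> * y - t" and eq: "\<sigma> * (y - (y + (- \<sigma>) * t)) = t"
      using \<sigma> by (simp_all add: algebra_simps flip: mult.assoc)
    moreover have "f (y + (- \<sigma>) * t) = exp (\<sigma> * y) * exp (- t)" if "t \<ge> 0"
      using f[OF that] by simp
    ultimately show "indicator {\<eta>. \<sigma> * \<eta> \<le> \<sigma> * y} (y + (- \<sigma>) * t) *
      (f (y + (- \<sigma>) * t) / (\<sigma> * (y - (y + (- \<sigma>) * t))) powr (1 - s)) =
      exp (\<sigma> * y) * (indicator {0..} t * (t powr (s - 1) * exp (- t)))"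
      unfolding eq using powr_minus_divide[of t "1 - s"] by (auto split: split_indicator simp del: mult_minus_left)
  qed
  also have "\<dots> = exp (\<sigma> * y) * Gamma s"
    using has_bochner_integral_Gamma[OF \<open>s > 0\<close>] by (simp add: has_bochner_integral_iff)
  finally show ?thesis .
qed

fun side_sign :: "side \<Rightarrow> real" where
  "side_sign Left_side = 1"
| "side_sign Right_side = - 1"

text \<open>The kernel integral is Gamma(n - \<alpha>) e^(\<sigma> y). Its n-th derivative yields
  \<sigma>^n, which cancels against the sign \<sigma>^n in the definition. Strictness in \<sigma> x
  < 0 provides a neighbourhood of x on which this formula can be differentiated.\<close>

lemma RL_deriv_exp:
  assumes "\<alpha> > 0" and f: "\<And>x. side_sign s * x \<le> 0 \<Longrightarrow> f x = exp (side_sign s * x)"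
    and x: "side_sign s * x < 0"
  shows "RL_deriv s \<alpha> f x = exp (side_sign s * x)"
proof -
  define \<sigma> n where "\<sigma> = side_sign s" and "n = frac_ord \<alpha>"
  have \<sigma>: "\<bar>\<sigma>\<bar> = 1" "\<sigma> ^ n * \<sigma> ^ n = 1"
    by (cases s; simp add: \<sigma>_def flip: power_mult_distrib)+
  have pos: "real n - \<alpha> > 0" unfolding n_def by (rule frac_ord_greater)
  have RL: "RL_deriv s \<alpha> f x = \<sigma> ^ n / Gamma (real n - \<alpha>) *
      (deriv ^^ n) (\<lambda>y. LBINT \<eta>:{\<eta>. \<sigma> * \<eta> \<le> \<sigma> * y}. f \<eta> / (\<sigma> * (y - \<eta>)) powr (1 - (real n - \<alpha>))) x"
    by (cases s) (simp_all add: RL_left_def RL_right_def Let_def \<sigma>_def n_def atMost_def atLeast_def algebra_simps)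
  have "open {y. \<sigma> * y < 0}"
    by (intro open_Collect_less continuous_intros)
  then have "\<forall>\<^sub>F y in nhds x. y \<in> {y. \<sigma> * y < 0}"
    using x by (intro eventually_nhds_in_open) (auto simp: \<sigma>_def)
  then have "\<forall>\<^sub>F y in nhds x. (LBINT \<eta>:{\<eta>. \<sigma> * \<eta> \<le> \<sigma> * y}. f \<eta> / (\<sigma> * (y - \<eta>)) powr (1 - (real n - \<alpha>))) =
      Gamma (real n - \<alpha>) * exp (\<sigma> * y)"
  proof eventually_elim
    case (elim y)
    then have "\<sigma> * y < 0" by simp
    show ?case
    proof (subst RL_kernel_exp_integral[OF pos _ \<sigma>(1)])
      fix t :: real assume "t \<ge> 0"
      have "\<sigma> * (y - \<sigma> * t) = \<sigma> * y - t"
        by (cases s) (simp_all add: \<sigma>_def)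
      then show "f (y - \<sigma> * t) = exp (\<sigma> * y) * exp (- t)"
        using f[of "y - \<sigma> * t"] \<open>\<sigma> * y < 0\<close> \<open>t \<ge> 0\<close> by (simp add: \<sigma>_def[symmetric] flip: exp_add)
    qed simp
  qed
  then have "(deriv ^^ n) (\<lambda>y. LBINT \<eta>:{\<eta>. \<sigma> * \<eta> \<le> \<sigma> * y}. f \<eta> / (\<sigma> * (y - \<eta>)) powr (1 - (real n - \<alpha>))) x =
      Gamma (real n - \<alpha>) * \<sigma> ^ n * exp (\<sigma> * x)"
    by (subst higher_deriv_cong_ev[OF _ refl]) (auto simp: higher_deriv_exp)
  moreover have "Gamma (real n - \<alpha>) > 0" using pos by (rule Gamma_real_pos)
  ultimately show ?thesis
    using \<sigma> unfolding RL by (simp add: \<sigma>_def[symmetric])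
qed

text \<open>Multiplied by \<sigma>, the nodes are \<sigma> x + r h - k h, largest for k = 0. Hence
  one bound on h > 0 keeps all of them in the half-line.\<close>

lemma exp_at_G_nodes:
  assumes f: "\<And>x. side_sign s * x \<le> 0 \<Longrightarrow> f x = exp (side_sign s * x)"
    and x: "side_sign s * x < 0"
  shows "\<forall>\<^sub>F h in at_right 0. (\<forall>k. f (G_node s r h x k) = exp (side_sign s * x) * exp (r * h) * exp (- h) ^ k)"
proof -
  define \<sigma> where "\<sigma> = side_sign s"
  have "\<forall>\<^sub>F h in at_right 0. \<sigma> * x + r * h < 0"
    using x unfolding \<sigma>_def[symmetric] by (intro order_tendstoD) (auto intro!: tendsto_eq_intros)
  with eventually_at_right_less show ?thesis
  proof eventually_elim
    case (elim h)
    show ?case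
    proof
      fix k
      have "\<sigma> * G_node s r h x k = \<sigma> * x + r * h + real k * (- h)"
        by (cases s) (simp_all add: \<sigma>_def algebra_simps)
      moreover have "\<sigma> * x + r * h + real k * (- h) \<le> 0"
        using elim mult_nonneg_nonneg[of "real k" h] by (simp only: mult_minus_right) linarith
      ultimately show "f (G_node s r h x k) = exp (side_sign s * x) * exp (r * h) * exp (- h) ^ k"
        using f[of "G_node s r h x k"] elim
        by (simp add: \<sigma>_def[symmetric] exp_of_nat_mult[symmetric] flip: exp_add)
    qed
  qed
qed

section \<open>The Vandermonde system\<close>

text \<open>Pair the moments with the product of m - X over m other than j, which vanishes at every
  node but j. Expanded in powers of lam - X, only the power d meets a nonzero moment, and its
  coefficient is, up to sign, an elementary symmetric polynomial of degree N - 1 - d = p -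
  1.\<close>

lemma power_sums_imp_beta:
  fixes \<beta> :: "nat \<Rightarrow> real"
  assumes "N = p + d" "p \<ge> 1"
    and moments: "\<And>m. m < N \<Longrightarrow> (\<Sum>i<N. \<beta> i * (lam - real i) ^ m) = (if m = d then fact d else 0)"
    and "j < N"
  shows "\<beta> j = beta_num lam p N j / beta_den d N j"
proof -
  define A where "A = {..<N} - {j}"
  have [simp]: "finite A" and card_A: "card A = N - 1"
    using \<open>j < N\<close> by (auto simp: A_def)
  \<comment> \<open>Each factor is split as m - i = -(lam - m) + (lam - i).\<close>
  have expand: "(\<Prod>m\<in>A. real m - real i) =
      (\<Sum>X\<in>Pow A. (\<Prod>m\<in>X. - (lam - real m)) * (lam - real i) ^ card (A - X))" for i
    using prod_add[of A "\<lambda>m. - (lam - real m)" "\<lambda>_. lam - real i"] by simp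
  have "\<beta> j * (\<Prod>m\<in>A. real m - real j) = (\<Sum>i<N. \<beta> i * (\<Prod>m\<in>A. real m - real i))"
  proof -
    have "(\<Sum>i<N. \<beta> i * (\<Prod>m\<in>A. real m - real i)) = (\<Sum>i\<in>{j}. \<beta> i * (\<Prod>m\<in>A. real m - real i))"
      using \<open>j < N\<close> by (intro sum.mono_neutral_right) (auto simp: A_def)
    then show ?thesis by simp
  qed
  also have "\<dots> = (\<Sum>X\<in>Pow A. (\<Prod>m\<in>X. - (lam - real m)) * (\<Sum>i<N. \<beta> i * (lam - real i) ^ card (A - X)))"
    unfolding expand sum_distrib_left by (subst sum.swap) (simp add: mult_ac)
  also have "\<dots> = (\<Sum>X\<in>Pow A. if card X = p - 1 then fact d * (- 1) ^ (p - 1) * (\<Prod>m\<in>X. lam - real m) else 0)"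
  proof (rule sum.cong)
    fix X assume "X \<in> Pow A"
    then have "X \<subseteq> A" "finite X" by (auto intro: finite_subset)
    then have card: "card (A - X) = N - 1 - card X" "card X \<le> N - 1"
      using card_A card_mono[of A X] by (auto simp: card_Diff_subset)
    then have "card (A - X) < N" "card (A - X) = d \<longleftrightarrow> card X = p - 1"
      using assms by auto
    moreover have "(\<Prod>m\<in>X. - (lam - real m)) = (- 1) ^ card X * (\<Prod>m\<in>X. lam - real m)"
      by (rule prod_uminus)
    ultimately show "(\<Prod>m\<in>X. - (lam - real m)) * (\<Sum>i<N. \<beta> i * (lam - real i) ^ card (A - X)) =
        (if card X = p - 1 then fact d * (- 1) ^ (p - 1) * (\<Prod>m\<in>X. lam - real m) else 0)"
      by (simp only: moments) (simp del: minus_diff_eq)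
  qed simp
  also have "\<dots> = (\<Sum>X | X \<in> Pow A \<and> card X = p - 1. fact d * (- 1) ^ (p - 1) * (\<Prod>m\<in>X. lam - real m))"
    by (rule sum.inter_filter[symmetric]) simp
  also have "\<dots> = fact d * (- 1) ^ (p - 1) * beta_num lam p N j"
    unfolding beta_num_def A_def Pow_iff sum_distrib_left ..
  also have "(\<Prod>m\<in>A. real m - real j) = (- 1) ^ (N - 1) * (\<Prod>m\<in>A. real j - real m)"
    using prod_uminus[of "\<lambda>m. real j - real m" A] by (simp add: card_A)
  finally have eq: "\<beta> j * ((- 1) ^ (N - 1) * (\<Prod>m\<in>A. real j - real m)) =
      fact d * (- 1) ^ (p - 1) * beta_num lam p N j" .
  have "(\<Prod>m\<in>A. real j - real m) \<noteq> 0"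
    by (auto simp: A_def)
  \<comment> \<open>Of the sign caused by reversing N - 1 differences, (-1)^(p-1) cancels and the
    (-1)^d of \<open>beta_den\<close> remains.\<close>
  moreover have "(- 1 :: real) ^ (N - 1) = (- 1) ^ (p - 1) * (- 1) ^ d"
    using assms by (simp flip: power_add)
  ultimately have "\<beta> j * ((- 1) ^ d * (\<Prod>m\<in>A. real j - real m)) = fact d * beta_num lam p N j"
    using eq by simp
  moreover have "(- 1 :: real) ^ d \<noteq> 0" by simp
  ultimately show ?thesis
    using \<open>(\<Prod>m\<in>A. real j - real m) \<noteq> 0\<close> unfolding beta_den_def A_def[symmetric]
    by (simp add: divide_simps mult_ac)
qed

section \<open>Continuation of the generating function to the point 1\<close>

text \<open>S need not be simply connected, so P^c may have no branch on S, but |P|^c is single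
  valued. Locally, F divided by a branch of P^c has constant modulus where the identity holds, hence
  is constant there and on the whole ball; so the identity spreads through S.\<close>

lemma norm_eq_powr_continuation:
  fixes F P :: "complex \<Rightarrow> complex" and c :: real
  assumes F: "F holomorphic_on S" and P: "P holomorphic_on S"
    and S: "open S" "connected S" and nz: "\<And>z. z \<in> S \<Longrightarrow> P z \<noteq> 0"
    and "a \<in> S" "b \<in> S"
    and a: "\<forall>\<^sub>F z in nhds a. norm (F z) = norm (P z) powr c"
  shows "norm (F b) = norm (P b) powr c"
proof -
  let ?Q = "\<lambda>x. \<forall>\<^sub>F z in nhds x. norm (F z) = norm (P z) powr c"
  have "?Q b"
  proof (rule connected_induction_simple[where P = ?Q, OF S(2) \<open>a \<in> S\<close> \<open>b \<in> S\<close> a])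
    fix z0 assume "z0 \<in> S"
    define q where "q z = P z / P z0" for z
    have "continuous_on S q"
      unfolding q_def using P nz \<open>z0 \<in> S\<close> by (intro continuous_intros holomorphic_on_imp_continuous_on) auto
    \<comment> \<open>Near z0 the quotient q is close to 1, so its principal power stays away from
      the branch cut.\<close>
    then have "open (S \<inter> q -` {z. Re z > 0})"
      using S(1) by (intro continuous_open_preimage open_halfspace_Re_gt)
    moreover have "z0 \<in> S \<inter> q -` {z. Re z > 0}"
      using \<open>z0 \<in> S\<close> nz by (simp add: q_def)
    ultimately obtain e where e: "e > 0" "ball z0 e \<subseteq> S \<inter> q -` {z. Re z > 0}"
      by (metis open_contains_ball)
    define B where "B = ball z0 e"
    have B: "open B" "connected B" "z0 \<in> B" "B \<subseteq> S" and q_pos: "\<And>z. z \<in> B \<Longrightarrow> Re (q z) > 0"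
      using e by (auto simp: B_def)
    define k where "k z = F z / q z powr of_real c" for z
    have "q holomorphic_on B"
      unfolding q_def using P B nz \<open>z0 \<in> S\<close> by (intro holomorphic_intros) (auto elim: holomorphic_on_subset)
    then have k: "k holomorphic_on B"
      unfolding k_def using F B q_pos
      by (intro holomorphic_intros) (force elim: holomorphic_on_subset simp: complex_nonpos_Reals_iff)+
    have norm_k: "norm (F z) = norm (P z) powr c \<longleftrightarrow> norm (k z) = norm (P z0) powr c" if "z \<in> B" for z
    proof -
      have "q z \<noteq> 0" using q_pos[OF that] by auto
      then have "norm (q z powr of_real c) = norm (P z) powr c / norm (P z0) powr c"
        by (simp add: norm_powr_real_powr' q_def norm_divide powr_divide)
      then have "norm (k z) = norm (F z) * norm (P z0) powr c / norm (P z) powr c"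
        by (simp add: k_def norm_divide)
      moreover have "norm (P z) powr c > 0" "norm (P z0) powr c > 0"
        using nz that B by auto
      ultimately show ?thesis
        by (metis less_irrefl mult.commute mult_cancel_right nonzero_divide_eq_eq)
    qed
    have "?Q y" if "x \<in> B" "y \<in> B" "?Q x" for x y
    proof -
      have "\<forall>\<^sub>F z in nhds x. z \<in> B \<and> norm (k z) = norm (P z0) powr c"
        using \<open>?Q x\<close> eventually_nhds_in_open[OF B(1) \<open>x \<in> B\<close>]
        by eventually_elim (auto simp: norm_k)
      then obtain U where U: "open U" "x \<in> U" "\<And>z. z \<in> U \<Longrightarrow> z \<in> B \<and> norm (k z) = norm (P z0) powr c"
        unfolding eventually_nhds by blast
      \<comment> \<open>As |k| is constant on U, the point x is a local maximum of it.\<close>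
      have "k constant_on B"
        by (rule maximum_modulus_principle[OF k B(1,2) U(1) _ U(2)]) (use U in auto)
      then have "norm (k z) = norm (P z0) powr c" if "z \<in> B" for z
        using that \<open>x \<in> B\<close> U(2) U(3)[of x] by (auto simp: constant_on_def)
      then show ?thesis
        using eventually_nhds_in_open[OF B(1) \<open>y \<in> B\<close>] by (auto elim!: eventually_mono simp: norm_k)
    qed
    then show "\<exists>T. openin (top_of_set S) T \<and> z0 \<in> T \<and> (\<forall>x\<in>T. \<forall>y\<in>T. ?Q x \<longrightarrow> ?Q y)"
      using open_subset[OF B(4) B(1)] B(3) by blast
  qed
  then show ?thesis
    by (rule eventually_nhds_x_imp_x)
qed

text \<open>Once the coefficients below m vanish, A(h) / h^m tends to c m by the series and to 0 by
  the bound, since m < K.\<close>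

lemma powser_bigo_imp_coeff_0:
  fixes c :: "nat \<Rightarrow> real"
  assumes sums: "\<forall>\<^sub>F h in at_right 0. (\<lambda>m. c m * h ^ m) sums A h"
    and bigo: "A \<in> O[at_right 0](\<lambda>h. h ^ K)"
    and "m < K"
  shows "c m = 0"
  using \<open>m < K\<close>
proof (induction m rule: less_induct)
  case (less m)
  obtain h0 where h0: "h0 > 0" and sums_A: "\<And>h. 0 < h \<Longrightarrow> h < h0 \<Longrightarrow> (\<lambda>m. c m * h ^ m) sums A h"
    using sums by (auto simp: eventually_at_right_field)
  define B where "B x = (\<Sum>i. c (i + m) * x ^ i)" for x
  have B: "(\<lambda>i. c (i + m) * x ^ i) sums B x" if "norm x < h0 / 2" for x
  proof -
    \<comment> \<open>Convergence at the single point h0 / 2 extends to |x| < h0 / 2, so the tail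
      series has a two-sided limit at 0.\<close>
    have "summable (\<lambda>i. c i * (h0 / 2) ^ i)"
      using sums_A[of "h0 / 2"] h0 by (auto simp: sums_iff)
    then have "summable (\<lambda>i. c (i + m) * (h0 / 2) ^ (i + m))"
      by (rule summable_ignore_initial_segment)
    then have "summable (\<lambda>i. c (i + m) * (h0 / 2) ^ i * (h0 / 2) ^ m)"
      by (simp add: power_add mult_ac)
    then have "summable (\<lambda>i. c (i + m) * (h0 / 2) ^ i)"
      using h0 summable_mult2[of "\<lambda>i. c (i + m) * (h0 / 2) ^ i * (h0 / 2) ^ m" "inverse ((h0 / 2) ^ m)"]
      by (simp add: mult.assoc)
    then have "summable (\<lambda>i. c (i + m) * x ^ i)"
      by (rule powser_inside) (use that in auto)
    then show ?thesis
      by (simp add: B_def summable_sums)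
  qed
  have "(B \<longlongrightarrow> c m) (at 0)"
    using powser_limit_0[of "h0 / 2" "\<lambda>i. c (i + m)" B] B h0 by simp
  then have lim: "(B \<longlongrightarrow> c m) (at_right 0)"
    by (rule filterlim_mono) (auto simp: at_le)
  have "\<forall>\<^sub>F h in at_right 0. 0 < h \<and> h < h0 / 2"
    using h0 by (auto simp: eventually_at_right_field intro: exI[of _ "h0 / 2"])
  then have AB: "\<forall>\<^sub>F h in at_right 0. A h / h ^ m = B h"
  proof eventually_elim
    case (elim h)
    have "(\<lambda>i. c (i + m) * h ^ (i + m)) sums (A h - (\<Sum>i<m. c i * h ^ i))"
      using elim h0 by (intro sums_split_initial_segment sums_A) auto
    also have "(\<Sum>i<m. c i * h ^ i) = 0"
      using less by (intro sum.neutral) auto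
    finally have "(\<lambda>i. c (i + m) * h ^ i * h ^ m) sums A h"
      by (simp add: power_add mult_ac)
    moreover have "(\<lambda>i. c (i + m) * h ^ i * h ^ m) sums (B h * h ^ m)"
      using B[of h] elim by (intro sums_mult2) auto
    ultimately have "A h = B h * h ^ m"
      by (rule sums_unique2)
    then show ?case using elim by simp
  qed
  have "(\<lambda>h. A h / h ^ m) \<in> O[at_right 0](\<lambda>h. h ^ K / h ^ m)"
    using bigo by (intro landau_o.big.divide_right eventually_mono[OF eventually_at_right_less]) auto
  also have "(\<lambda>h::real. h ^ K / h ^ m) \<in> O[at_right 0](\<lambda>h. h ^ (K - m))"
    using less.prems
    by (intro bigoI[of _ 1] eventually_at_rightI[of 0 1]) (auto simp: power_diff)
  also have "(\<lambda>h::real. h ^ (K - m)) \<in> o[at_right 0](\<lambda>_. 1)"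
    using less.prems by (intro smalloI_tendsto) (auto intro!: tendsto_eq_intros)
  finally have "((\<lambda>h. A h / h ^ m) \<longlongrightarrow> 0) (at_right 0)"
    by (auto dest: smalloD_tendsto)
  then have "(B \<longlongrightarrow> 0) (at_right 0)"
    by (rule Lim_transform_eventually) (use AB in simp)
  with lim show ?case
    using tendsto_unique trivial_limit_at_right_real by blast
qed

section \<open>From the approximation order to the symbol\<close>

text \<open>The point x = -\<sigma> gives \<sigma> x = -1, strictly inside the half-line. One f and
  one x serve every order \<alpha>, so the factor e^(-1) can be cancelled from a whole error
  expansion.\<close>

lemma exponential_test_function:
  obtains f x where "smooth_L1 K f" "\<And>\<alpha>. \<alpha> > 0 \<Longrightarrow> RL_deriv s \<alpha> f x = exp (- 1)"
    "\<forall>\<^sub>F h in at_right 0. \<forall>k. f (G_node s r h x k) = exp (- 1) * exp (r * h) * exp (- h) ^ k"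
proof -
  have "side_sign s \<noteq> 0" by (cases s) auto
  then obtain f where f: "smooth_L1 K f" "\<And>x. side_sign s * x \<le> 0 \<Longrightarrow> f x = exp (side_sign s * x)"
    using exists_exponential_smooth_L1 by blast
  define x where "x = - side_sign s"
  have x: "side_sign s * x = - 1" by (cases s) (auto simp: x_def)
  show ?thesis
  proof (rule that)
    show "RL_deriv s \<alpha> f x = exp (- 1)" if "\<alpha> > 0" for \<alpha>
      using RL_deriv_exp[OF that f(2), where x = x] x by simp
    show "\<forall>\<^sub>F h in at_right 0. \<forall>k. f (G_node s r h x k) = exp (- 1) * exp (r * h) * exp (- h) ^ k"
      using exp_at_G_nodes[OF f(2), where x = x and r = r] x by simp
  qed (fact f)
qed

lemma G_diff_eq_G_symbol:
  assumes "\<forall>k. f (G_node s r h x k) = C * exp (r * h) * exp (- h) ^ k"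
    and "summable (\<lambda>k. w k * exp (- h) ^ k)"
  shows "G_diff s w \<alpha> r h f x = C * G_symbol w \<alpha> r h"
proof -
  have "(\<Sum>k. w k * f (G_node s r h x k)) = (\<Sum>k. (C * exp (r * h)) * (w k * exp (- h) ^ k))"
    using assms(1) by (simp add: mult_ac)
  also have "\<dots> = C * exp (r * h) * (\<Sum>k. w k * exp (- h) ^ k)"
    using assms(2) by (rule suminf_mult)
  finally show ?thesis
    by (simp add: G_diff_def G_symbol_def)
qed

text \<open>On the test function the error is e^(-1) (G(h) - 1). The convergence clause of
  \<open>G_approximates\<close> becomes convergence of the generating series at points arbitrarily
  close to 1.\<close>

lemma G_approximates_imp_symbol:
  assumes "\<alpha> > 0" "G_approximates s w \<alpha> p r"
  shows "\<forall>\<^sub>F h in at_right 0. summable (\<lambda>k. w k * exp (- h) ^ k)"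
    and "(\<lambda>h. G_symbol w \<alpha> r h - 1) \<in> O[at_right 0](\<lambda>h. h ^ p)"
proof -
  obtain M where M: "\<And>f x. smooth_L1 (M + frac_ord \<alpha> + 1) f \<Longrightarrow>
       (\<forall>\<^sub>F h in at_right 0. summable (\<lambda>k. w k * f (G_node s r h x k))) \<and>
       (\<lambda>h. G_diff s w \<alpha> r h f x - RL_deriv s \<alpha> f x) \<in> O[at_right 0](\<lambda>h. h ^ p)"
    using assms(2) unfolding G_approximates_def by blast
  obtain f x where f: "smooth_L1 (M + frac_ord \<alpha> + 1) f"
    and RL: "RL_deriv s \<alpha> f x = exp (- 1)"
    and node: "\<forall>\<^sub>F h in at_right 0. \<forall>k. f (G_node s r h x k) = exp (- 1) * exp (r * h) * exp (- h) ^ k"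
    by (rule exponential_test_function[of "M + frac_ord \<alpha> + 1" s r]) (use assms(1) in auto)
  from M[OF f, of x] have summ: "\<forall>\<^sub>F h in at_right 0. summable (\<lambda>k. w k * f (G_node s r h x k))"
    and bigo: "(\<lambda>h. G_diff s w \<alpha> r h f x - exp (- 1)) \<in> O[at_right 0](\<lambda>h. h ^ p)"
    by (auto simp: RL)
  show summ': "\<forall>\<^sub>F h in at_right 0. summable (\<lambda>k. w k * exp (- h) ^ k)"
    using summ node
  proof eventually_elim
    case (elim h)
    then have "summable (\<lambda>k. (exp (- 1) * exp (r * h)) * (w k * exp (- h) ^ k))"
      by (simp add: mult_ac)
    then show ?case
      by (subst (asm) summable_cmult_iff) simp
  qed
  have "\<forall>\<^sub>F h in at_right 0. G_diff s w \<alpha> r h f x - exp (- 1) = exp (- 1) * (G_symbol w \<alpha> r h - 1)"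
    using node summ' by eventually_elim (simp add: G_diff_eq_G_symbol algebra_simps)
  with bigo have "(\<lambda>h. exp (- 1) * (G_symbol w \<alpha> r h - 1)) \<in> O[at_right 0](\<lambda>h. h ^ p)"
    by (simp cong: landau_o.big.in_cong)
  then show "(\<lambda>h. G_symbol w \<alpha> r h - 1) \<in> O[at_right 0](\<lambda>h. h ^ p)"
    by simp
qed

lemma error_expansion_imp_symbol:
  assumes "\<alpha> > 0" "error_expansion s w \<alpha> p r M b"
    and summ: "\<forall>\<^sub>F h in at_right 0. summable (\<lambda>k. w k * exp (- h) ^ k)"
  shows "(\<lambda>h. G_symbol w \<alpha> r h - 1 - (\<Sum>l=p..M. b l * h ^ l)) \<in> O[at_right 0](\<lambda>h. h ^ (M + 1))"
proof -
  obtain f x where f: "smooth_L1 (M + frac_ord \<alpha> + 1) f"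
    and RL: "\<And>\<alpha>. \<alpha> > 0 \<Longrightarrow> RL_deriv s \<alpha> f x = exp (- 1)"
    and node: "\<forall>\<^sub>F h in at_right 0. \<forall>k. f (G_node s r h x k) = exp (- 1) * exp (r * h) * exp (- h) ^ k"
    by (rule exponential_test_function[of "M + frac_ord \<alpha> + 1" s r]) auto
  have bigo: "(\<lambda>h. G_diff s w \<alpha> r h f x - exp (- 1) - (\<Sum>l=p..M. h ^ l * b l * exp (- 1)))
      \<in> O[at_right 0](\<lambda>h. h ^ (M + 1))"
    using assms(2)[unfolded error_expansion_def, rule_format, OF f, of x] assms(1) RL[of \<alpha>]
      RL[of "\<alpha> + real l" for l]
    by (simp add: add_pos_nonneg)
  have "\<forall>\<^sub>F h in at_right 0. G_diff s w \<alpha> r h f x - exp (- 1) - (\<Sum>l=p..M. h ^ l * b l * exp (- 1)) =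
      exp (- 1) * (G_symbol w \<alpha> r h - 1 - (\<Sum>l=p..M. b l * h ^ l))"
    using node summ
    by eventually_elim (simp add: G_diff_eq_G_symbol algebra_simps sum_distrib_left)
  with bigo have "(\<lambda>h. exp (- 1) * (G_symbol w \<alpha> r h - 1 - (\<Sum>l=p..M. b l * h ^ l)))
      \<in> O[at_right 0](\<lambda>h. h ^ (M + 1))"
    by (simp cong: landau_o.big.in_cong)
  then show ?thesis by simp
qed

text \<open>The difference of the two expansions is a convergent power series of size O(h^(M+1)), so
  its coefficients up to M vanish.\<close>

lemma error_expansion_unique:
  assumes "\<alpha> > 0" "symbol_expansion w \<alpha> p r a" "error_expansion s w \<alpha> p r M b"
    and summ: "\<forall>\<^sub>F h in at_right 0. summable (\<lambda>k. w k * exp (- h) ^ k)"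
    and "l \<in> {p..M}"
  shows "b l = a l"
proof -
  \<comment> \<open>\<open>symbol_expansion\<close> says nothing about a below p, hence the 0
    there.\<close>
  define c where "c m = (if m < p then 0 else a m) - (if m \<in> {p..M} then b m else 0)" for m
  have "\<forall>\<^sub>F h in at_right 0. (\<lambda>m. c m * h ^ m) sums (G_symbol w \<alpha> r h - 1 - (\<Sum>l=p..M. b l * h ^ l))"
    using assms(2) unfolding symbol_expansion_def
  proof eventually_elim
    case (elim h)
    then have "(\<lambda>i. (if i + p < p then 0 else a (i + p)) * h ^ (i + p)) sums (G_symbol w \<alpha> r h - 1)"
      by (simp add: add.commute)
    then have "(\<lambda>m. (if m < p then 0 else a m) * h ^ m) sums
        (G_symbol w \<alpha> r h - 1 + (\<Sum>m<p. (if m < p then 0 else a m) * h ^ m))"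
      by (subst (asm) sums_iff_shift)
    moreover have "(\<lambda>m. if m \<in> {p..M} then b m * h ^ m else 0) sums (\<Sum>l=p..M. b l * h ^ l)"
      by (rule sums_If_finite_set) simp
    ultimately have "(\<lambda>m. (if m < p then 0 else a m) * h ^ m - (if m \<in> {p..M} then b m * h ^ m else 0))
        sums (G_symbol w \<alpha> r h - 1 + (\<Sum>m<p. (if m < p then 0 else a m) * h ^ m) - (\<Sum>l=p..M. b l * h ^ l))"
      by (rule sums_diff)
    moreover have "(\<lambda>m. (if m < p then 0 else a m) * h ^ m - (if m \<in> {p..M} then b m * h ^ m else 0)) = (\<lambda>m. c m * h ^ m)"
      by (auto simp: c_def left_diff_distrib)
    ultimately show ?case by simp
  qed
  then have "c l = 0"
    by (rule powser_bigo_imp_coeff_0[OF _ error_expansion_imp_symbol[OF assms(1,3) summ]])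
       (use \<open>l \<in> {p..M}\<close> in auto)
  then show ?thesis
    using \<open>l \<in> {p..M}\<close> by (auto simp: c_def)
qed

section \<open>Real powers near 1 and the generating function there\<close>

lemma powr_minus_one_bigo:
  fixes f g :: "real \<Rightarrow> real"
  assumes "(\<lambda>h. f h - 1) \<in> O[F](g)" "(f \<longlongrightarrow> 1) F"
  shows "(\<lambda>h. f h powr s - 1) \<in> O[F](g)"
proof -
  have "((\<lambda>x. x powr s) has_real_derivative s * 1 powr (s - 1)) (at 1)"
    by (auto intro!: derivative_eq_intros)
  then have "((\<lambda>x. (x powr s - 1) / (x - 1)) \<longlongrightarrow> s) (at 1)"
    by (simp add: has_field_derivative_iff)
  \<comment> \<open>The difference quotient of x^s at 1 tends to s, so near 1 it is bounded by |s| +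
    1.\<close>
  then have "\<forall>\<^sub>F x in at 1. dist ((x powr s - 1) / (x - 1)) s < 1"
    by (rule tendstoD) simp
  then have "\<forall>\<^sub>F x in nhds 1. \<bar>x powr s - 1\<bar> \<le> (\<bar>s\<bar> + 1) * \<bar>x - 1\<bar>"
    unfolding eventually_at_filter
  proof eventually_elim
    case (elim x)
    show ?case
    proof (cases "x = 1")
      case False
      with elim have "\<bar>(x powr s - 1) / (x - 1) - s\<bar> < 1"
        by (simp add: dist_real_def)
      then have "\<bar>(x powr s - 1) / (x - 1)\<bar> \<le> \<bar>s\<bar> + 1"
        by linarith
      then show ?thesis using False by (simp add: abs_divide divide_le_eq)
    qed simp
  qed
  then have "\<forall>\<^sub>F h in F. \<bar>f h powr s - 1\<bar> \<le> (\<bar>s\<bar> + 1) * \<bar>f h - 1\<bar>"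
    by (rule eventually_compose_filterlim) (fact assms(2))
  then have "(\<lambda>h. f h powr s - 1) \<in> O[F](\<lambda>h. f h - 1)"
    by (intro bigoI[of _ "\<bar>s\<bar> + 1"]) simp
  then show ?thesis
    using assms(1) by (rule landau_o.big.trans)
qed

lemma bigo_power_imp_tendsto_0:
  fixes f :: "real \<Rightarrow> real"
  assumes "f \<in> O[at_right 0](\<lambda>h. h ^ p)" "p \<ge> 1"
  shows "(f \<longlongrightarrow> 0) (at_right 0)"
proof -
  note assms(1)
  also have "(\<lambda>h::real. h ^ p) \<in> o[at_right 0](\<lambda>_. 1)"
    using assms(2) by (intro smalloI_tendsto) (auto intro!: tendsto_eq_intros)
  finally show ?thesis
    by (auto dest: smalloD_tendsto)
qed

text \<open>Convergence at exp(-h) for small h makes W holomorphic in the unit disc. Removing the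
  finitely many zeros of P keeps the disc connected, so |W| = |P|^c passes from near 0 to exp(-h).
  The sign of W is left open.\<close>

lemma generating_function_near_1:
  assumes w: "poly_power_coeffs w N \<beta> c"
    and pos: "\<forall>\<^sub>F x in at_left 1. (\<Sum>j<N. \<beta> j * x ^ j) > 0"
    and summ: "\<forall>\<^sub>F h in at_right 0. summable (\<lambda>k. w k * exp (- h) ^ k)"
  shows "\<forall>\<^sub>F h in at_right 0. (\<Sum>j<N. \<beta> j * exp (- h) ^ j) > 0 \<and>
    \<bar>\<Sum>k. w k * exp (- h) ^ k\<bar> = (\<Sum>j<N. \<beta> j * exp (- h) ^ j) powr c"
proof -
  define P where "P z = (\<Sum>j<N. complex_of_real (\<beta> j) * z ^ j)" for z
  define F where "F = eval_fps (Abs_fps (\<lambda>k. complex_of_real (w k)))"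
  define Z where "Z = {z. P z = 0}"
  have P_real: "P (of_real x) = of_real (\<Sum>j<N. \<beta> j * x ^ j)" for x
    by (simp add: P_def)
  have lim1: "filterlim (\<lambda>h::real. exp (- h)) (at_left 1) (at_right 0)"
    by (auto simp: filterlim_at eventually_at_filter intro!: tendsto_eq_intros)
  have pos': "\<forall>\<^sub>F h in at_right 0. (\<Sum>j<N. \<beta> j * exp (- h) ^ j) > 0"
    using pos lim1 by (rule eventually_compose_filterlim)
  have "finite Z"
  proof -
    define Q where "Q = (\<Sum>j<N. monom (complex_of_real (\<beta> j)) j)"
    have Q: "poly Q z = P z" for z
      by (simp add: Q_def P_def poly_sum poly_monom)
    obtain h where "(\<Sum>j<N. \<beta> j * exp (- h) ^ j) > 0"
      using eventually_happens[OF pos'] by auto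
    then have "poly Q (of_real (exp (- h))) \<noteq> 0"
      unfolding Q P_real of_real_eq_0_iff by simp
    then have "Q \<noteq> 0" by auto
    then show ?thesis
      using poly_roots_finite[of Q] by (simp add: Z_def Q)
  qed
  define S where "S = ball 0 1 - Z"
  have S: "open S" "connected S"
    unfolding S_def using \<open>finite Z\<close>
    by (auto intro!: open_Diff finite_imp_closed connected_open_delete_finite)
  have F_hol: "F holomorphic_on S"
    unfolding F_def
  proof (rule holomorphic_on_eval_fps, rule subsetI)
    fix z assume "z \<in> S"
    then have "norm z < 1" by (simp add: S_def)
    have "((\<lambda>h::real. exp (- h)) \<longlongrightarrow> 1) (at_right 0)"
      by (auto intro!: tendsto_eq_intros)
    then have "\<forall>\<^sub>F h in at_right 0. norm z < exp (- h :: real)"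
      using \<open>norm z < 1\<close> by (rule order_tendstoD)
    with summ have "\<forall>\<^sub>F h in at_right 0. norm z < exp (- h :: real) \<and> summable (\<lambda>k. w k * exp (- h) ^ k)"
      by eventually_elim simp
    then obtain h :: real where h: "norm z < exp (- h)" "summable (\<lambda>k. w k * exp (- h) ^ k)"
      using eventually_happens trivial_limit_at_right_real by blast
    have "summable (\<lambda>k. complex_of_real (w k * exp (- h) ^ k))"
      using h(2) by (rule summable_of_real)
    then have "ereal (norm (complex_of_real (exp (- h)))) \<le> conv_radius (\<lambda>k. complex_of_real (w k))"
      by (intro conv_radius_geI) simp
    with h(1) have "ereal (norm z) < conv_radius (\<lambda>k. complex_of_real (w k))"
      by (simp add: less_le_trans[of _ "ereal (exp (- h))"])
    then show "z \<in> eball 0 (fps_conv_radius (Abs_fps (\<lambda>k. complex_of_real (w k))))"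
      by (simp add: in_eball_iff fps_conv_radius_def)
  qed
  have P_hol: "P holomorphic_on S"
    unfolding P_def by (intro holomorphic_intros)
  obtain U where U: "open U" "0 \<in> U"
    and sums: "\<And>z. z \<in> U \<Longrightarrow> (\<lambda>k. complex_of_real (w k) * z ^ k) sums (P z powr complex_of_real c)"
    using w unfolding poly_power_coeffs_def P_def eventually_nhds by auto
  obtain e where e: "e > 0" "ball 0 e \<subseteq> U \<inter> ball 0 1"
    using openE[of "U \<inter> ball 0 1" 0] U by auto
  \<comment> \<open>The continuation starts at some z0 near 0, since 0 itself is a zero of P if
    \<open>\<beta> 0 = 0\<close>.\<close>
  have "infinite (ball (0 :: complex) e)"
    using uncountable_ball[OF e(1)] countable_finite by blast
  then obtain z0 where z0: "z0 \<in> ball 0 e" "z0 \<notin> Z"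
    using \<open>finite Z\<close> by (meson finite_subset subsetI)
  then have "z0 \<in> S" using e by (auto simp: S_def)
  have "\<forall>\<^sub>F z in nhds z0. z \<in> ball 0 e - Z"
    using z0 \<open>finite Z\<close> by (intro eventually_nhds_in_open) (auto intro!: open_Diff finite_imp_closed)
  then have near: "\<forall>\<^sub>F z in nhds z0. norm (F z) = norm (P z) powr c"
  proof eventually_elim
    case (elim z)
    then have "F z = P z powr of_real c"
      using sums[of z] e by (auto simp: F_def eval_fps_def sums_iff)
    then show ?case
      using elim by (simp add: norm_powr_real_powr' Z_def)
  qed
  show ?thesis
    using pos' eventually_at_right_less[of "0::real"] summ
  proof eventually_elim
    case (elim h)
    let ?x = "exp (- h)"
    have "P (of_real ?x) \<noteq> 0"
      unfolding P_real of_real_eq_0_iff using elim by simp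
    then have "of_real ?x \<in> S"
      using elim by (simp add: S_def Z_def)
    then have "norm (F (of_real ?x)) = norm (P (of_real ?x)) powr c"
      using \<open>z0 \<in> S\<close> by (intro norm_eq_powr_continuation[OF F_hol P_hol S _ _ _ near]) (auto simp: S_def Z_def)
    moreover have "F (of_real ?x) = of_real (\<Sum>k. w k * ?x ^ k)"
      using suminf_of_real[OF elim(3), where ?'a = complex] by (simp add: F_def eval_fps_def)
    ultimately show ?case
      using elim unfolding P_real norm_of_real by simp
  qed
qed

section \<open>Error coefficients\<close>

lemma fps_power_nth_eq_0:
  fixes v :: "'a :: comm_ring_1 fps"
  assumes "\<And>i. i < p \<Longrightarrow> v $ i = 0" "n < k * p"
  shows "(v ^ k) $ n = 0"
proof -
  have "v = fps_X ^ p * fps_shift p v"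
    by (rule fps_ext) (use assms(1) in \<open>auto simp: fps_X_power_mult_nth\<close>)
  then have "v ^ k = fps_X ^ (k * p) * fps_shift p v ^ k"
    by (metis power_mult power_mult_distrib mult.commute)
  then show ?thesis
    using assms(2) by (simp add: fps_X_power_mult_nth)
qed

lemma fps_square_nth_double:
  fixes v :: "'a :: comm_ring_1 fps"
  assumes "\<And>i. i < p \<Longrightarrow> v $ i = 0"
  shows "(v ^ 2) $ (2 * p) = (v $ p)\<^sup>2"
proof -
  have "v = fps_X ^ p * fps_shift p v"
    by (rule fps_ext) (use assms(1) in \<open>auto simp: fps_X_power_mult_nth\<close>)
  then have "v ^ 2 = fps_X ^ (2 * p) * fps_shift p v ^ 2"
    by (metis power_mult power_mult_distrib mult.commute)
  then show ?thesis
    by (simp add: fps_X_power_mult_nth power2_eq_square)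
qed

text \<open>In 1 + c v + c (c - 1) / 2 v^2 + ... the square starts at order 2 p and the cube at 3 p
  > 2 p.\<close>

lemma fps_binomial_compose_nth:
  fixes v :: "complex fps"
  assumes v: "\<And>i. i < p \<Longrightarrow> v $ i = 0" and "p \<ge> 1"
  shows "(fps_binomial c oo v) $ 0 = 1"
    and "0 < n \<Longrightarrow> n < 2 * p \<Longrightarrow> (fps_binomial c oo v) $ n = c * v $ n"
    and "(fps_binomial c oo v) $ (2 * p) = c * v $ (2 * p) + c * (c - 1) / 2 * (v $ p)\<^sup>2"
proof -
  show "(fps_binomial c oo v) $ 0 = 1"
    by (simp add: fps_compose_nth)
  have vanish: "(v ^ i) $ n = 0" if "n < i * p" for i n
    using fps_power_nth_eq_0[of p v] v that by blast
  show "(fps_binomial c oo v) $ n = c * v $ n" if "0 < n" "n < 2 * p"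
  proof -
    have "(fps_binomial c oo v) $ n = (\<Sum>i\<in>{1}. (c gchoose i) * (v ^ i) $ n)"
      unfolding fps_compose_nth fps_binomial_nth
    proof (intro sum.mono_neutral_right ballI)
      fix i assume "i \<in> {0..n} - {1}"
      then consider "i = 0" | "i \<ge> 2" by force
      then show "(c gchoose i) * (v ^ i) $ n = 0"
      proof cases
        case 2
        then have "n < i * p" using that mult_le_mono1[of 2 i p] by linarith
        then show ?thesis by (simp add: vanish)
      qed (use that in simp)
    qed (use that in auto)
    then show ?thesis by simp
  qed
  have "(fps_binomial c oo v) $ (2 * p) = (\<Sum>i\<in>{1,2}. (c gchoose i) * (v ^ i) $ (2 * p))"
    unfolding fps_compose_nth fps_binomial_nth
  proof (intro sum.mono_neutral_right ballI)
    fix i assume "i \<in> {0..2 * p} - {1, 2}"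
    then consider "i = 0" | "i \<ge> 3" by force
    then show "(c gchoose i) * (v ^ i) $ (2 * p) = 0"
    proof cases
      case 2
      then have "2 * p < i * p" using \<open>p \<ge> 1\<close> mult_le_mono1[of 3 i p] by linarith
      then show ?thesis by (simp add: vanish)
    qed (use \<open>p \<ge> 1\<close> in simp)
  qed (use \<open>p \<ge> 1\<close> in auto)
  also have "\<dots> = c * v $ (2 * p) + c * (c - 1) / 2 * (v $ p)\<^sup>2"
    using fps_square_nth_double[of p v] v by (simp add: gbinomial_prod_rev numeral_2_eq_2)
  finally show "(fps_binomial c oo v) $ (2 * p) = c * v $ (2 * p) + c * (c - 1) / 2 * (v $ p)\<^sup>2" .
qed

(* Positivity near 1 fixes the sign of the base of the real power W(exp(-z)) as z -> 0+;
   W alone does not determine it, e.g. (1 - z)^2 = (-1 + z)^2.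
   At m = N + p the second-order term of (1 + u) powr (\<alpha>/d) enters for the first time. *)
theorem theorem2:
  fixes \<alpha> r lam :: real and d p N :: nat
    and \<beta> w :: "nat \<Rightarrow> real" and s :: side
  assumes "\<alpha> > 0" and "d \<ge> 1" and "p \<ge> 1"
    and "N = p + d" and "lam = r * real d / \<alpha>"
    and "poly_power_coeffs w N \<beta> (\<alpha> / real d)"
    and "\<forall>\<^sub>F x in at_left 1. (\<Sum>j<N. \<beta> j * x ^ j) > 0"
    and "G_approximates s w \<alpha> p r"
  shows "(\<forall>j<N. \<beta> j = beta_num lam p N j / beta_den d N j) \<and>
    (\<exists>a. symbol_expansion w \<alpha> p r a \<and>
         (\<forall>M\<ge>2 * p. \<forall>b. error_expansion s w \<alpha> p r M b \<longrightarrow> (\<forall>l\<in>{p..M}. b l = a l)) \<and>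
         (\<forall>m\<in>{N..<N + p}. a (m - d) = R_formula \<alpha> d lam N \<beta> m) \<and>
         a (N + p - d) = R_formula \<alpha> d lam N \<beta> (N + p)
                           + (\<alpha> - real d) / (2 * \<alpha>) * (a (N - d))\<^sup>2)"
proof -
  define c where "c = \<alpha> / real d"
  have "c > 0" using assms by (simp add: c_def)
  define G where "G = G_symbol w \<alpha> r"
  \<comment> \<open>This is exp(lam h) P(exp(-h)). As lam = r / c, it equals h^d G(h)^(1/c), which
    removes the power from the generator.\<close>
  define E where "E h = (\<Sum>j<N. \<beta> j * exp ((lam - real j) * h))" for h
  define e where "e m = (\<Sum>j<N. \<beta> j * (lam - real j) ^ m) / fact m" for m
  note summ = G_approximates_imp_symbol(1)[OF \<open>\<alpha> > 0\<close> \<open>G_approximates s w \<alpha> p r\<close>]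
  have G_bigo: "(\<lambda>h. G h - 1) \<in> O[at_right 0](\<lambda>h. h ^ p)"
    unfolding G_def by (rule G_approximates_imp_symbol(2)[OF \<open>\<alpha> > 0\<close> \<open>G_approximates s w \<alpha> p r\<close>])
  have G_lim: "(G \<longlongrightarrow> 1) (at_right 0)"
    using bigo_power_imp_tendsto_0[OF G_bigo \<open>p \<ge> 1\<close>] by (subst LIM_zero_iff[symmetric])
  then have G_pos: "\<forall>\<^sub>F h in at_right 0. G h > 0"
    by (rule order_tendstoD) simp
  have E_eq: "\<forall>\<^sub>F h in at_right 0. h > 0 \<and> G h > 0 \<and> E h = h ^ d * G h powr (1 / c)"
    using generating_function_near_1[OF assms(6,7) summ] G_pos eventually_at_right_less[of "0::real"]
  proof eventually_elim
    case (elim h)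
    define P where "P = (\<Sum>j<N. \<beta> j * exp (- h) ^ j)"
    define F where "F = (\<Sum>k. w k * exp (- h) ^ k)"
    have G: "G h = 1 / h powr \<alpha> * F * exp (r * h)"
      by (simp add: G_def G_symbol_def F_def)
    \<comment> \<open>Continuation gives only |F| = P^c; positivity of G decides the sign.\<close>
    with elim have "F > 0"
      by (simp add: zero_less_mult_iff zero_less_divide_iff)
    with elim have F: "F = P powr c" and "P > 0"
      by (auto simp: P_def F_def c_def)
    have "exp (lam * h) = exp (r * h) powr (1 / c)"
      using assms by (simp add: exp_powr_real c_def)
    moreover have "h ^ d = (h powr \<alpha>) powr (1 / c)"
      using assms elim by (simp add: powr_powr c_def powr_realpow)
    moreover have "P = F powr (1 / c)"
      using \<open>P > 0\<close> \<open>c > 0\<close> by (simp add: F powr_powr)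
    moreover have "E h = exp (lam * h) * P"
      by (simp add: E_def P_def sum_distrib_left mult.left_commute left_diff_distrib
            flip: exp_of_nat_mult exp_add)
    ultimately have "E h = h ^ d * G h powr (1 / c)"
      using elim \<open>F > 0\<close> by (simp add: G powr_mult powr_divide)
    then show ?case using elim by simp
  qed
  have E_sums: "(\<lambda>m. e m * h ^ m) sums E h" for h
  proof -
    have "(\<lambda>m. \<beta> j * (((lam - real j) * h) ^ m /\<^sub>R fact m)) sums (\<beta> j * exp ((lam - real j) * h))" for j
      by (intro sums_mult exp_converges)
    then have "(\<lambda>m. \<Sum>j<N. \<beta> j * (((lam - real j) * h) ^ m /\<^sub>R fact m)) sums E h"
      unfolding E_def by (intro sums_sum)
    moreover have "(\<lambda>m. \<Sum>j<N. \<beta> j * (((lam - real j) * h) ^ m /\<^sub>R fact m)) = (\<lambda>m. e m * h ^ m)"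
      by (simp add: e_def sum_distrib_left power_mult_distrib divide_inverse mult_ac)
    ultimately show ?thesis by simp
  qed
  have "(\<lambda>h. h ^ d * (G h powr (1 / c) - 1)) \<in> O[at_right 0](\<lambda>h. h ^ d * h ^ p)"
    by (intro landau_o.big.mult_left powr_minus_one_bigo G_bigo G_lim)
  moreover have "\<forall>\<^sub>F h in at_right 0. E h - h ^ d = h ^ d * (G h powr (1 / c) - 1)"
    using E_eq by eventually_elim (simp add: algebra_simps)
  ultimately have "(\<lambda>h. E h - h ^ d) \<in> O[at_right 0](\<lambda>h. h ^ d * h ^ p)"
    by (simp cong: landau_o.big.in_cong)
  then have E_bigo: "(\<lambda>h. E h - h ^ d) \<in> O[at_right 0](\<lambda>h. h ^ N)"
    by (simp add: \<open>N = p + d\<close> power_add mult.commute)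
  \<comment> \<open>Up to order N - 1 the series of E agrees with h^d; multiplied by m! these are
    the moment equations.\<close>
  have e: "e m = (if m = d then 1 else 0)" if "m < N" for m
  proof -
    have "(\<lambda>m. (e m - (if m = d then 1 else 0)) * h ^ m) sums (E h - h ^ d)" for h
      using sums_diff[OF E_sums[of h] sums_single[of d "\<lambda>m. h ^ m"]]
      by (simp add: left_diff_distrib if_distrib[of "\<lambda>x. x * _"] cong: if_cong)
    then have "e m - (if m = d then 1 else 0) = 0"
      by (intro powser_bigo_imp_coeff_0[OF _ E_bigo that]) auto
    then show ?thesis by simp
  qed
  have beta: "\<beta> j = beta_num lam p N j / beta_den d N j" if "j < N" for j
  proof (rule power_sums_imp_beta[OF \<open>N = p + d\<close> \<open>p \<ge> 1\<close> _ that])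
    fix m assume "m < N"
    then show "(\<Sum>i<N. \<beta> i * (lam - real i) ^ m) = (if m = d then fact d else 0)"
      using e[of m] by (auto simp: e_def split: if_splits)
  qed

  \<comment> \<open>Power series of the symbol\<close>
  define Ec where "Ec = (\<Sum>j<N. fps_const (complex_of_real (\<beta> j)) * fps_exp (complex_of_real (lam - real j)))"
  define Ez where "Ez z = (\<Sum>j<N. complex_of_real (\<beta> j) * exp (complex_of_real (lam - real j) * z))" for z
  have Ec_nth: "Ec $ m = of_real (e m)" for m
    by (simp add: Ec_def fps_sum_nth e_def sum_divide_distrib)
  have Ez: "Ez has_fps_expansion Ec"
    unfolding Ez_def Ec_def by (intro fps_expansion_intros)
  have "d \<le> subdegree Ec"
  proof (rule subdegree_geI)
    show "Ec \<noteq> 0" using Ec_nth[of d] e[of d] assms by auto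
    show "Ec $ i = 0" if "i < d" for i
      using Ec_nth[of i] e[of i] assms that by auto
  qed
  define v where "v = fps_shift d Ec - 1"
  \<comment> \<open>At real h > 0 near 0 this is G(h)^(1/c) - 1; the value at 0 fills the removable
    singularity.\<close>
  define V where "V z = (if z = 0 then Ec $ d else Ez z / z ^ d) - 1" for z
  have V: "V has_fps_expansion v"
    unfolding V_def v_def using Ez \<open>d \<le> subdegree Ec\<close> by (intro fps_expansion_intros) auto
  \<comment> \<open>Here i + d < N, and for i = 0 the subtracted 1 cancels e d = 1.\<close>
  have v_low: "v $ i = 0" if "i < p" for i
    using that e[of "i + d"] assms by (auto simp: v_def Ec_nth)
  have v_nth: "v $ i = of_real (e (i + d))" if "i > 0" for i
    using that by (simp add: v_def Ec_nth)
  define H where "H = fps_binomial (complex_of_real c) oo v"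
  \<comment> \<open>H is the series of (1 + V)^c, that is of G. Since G is real, the real parts of
    the coefficients already sum to it.\<close>
  define a where "a n = Re (H $ n)" for n
  note H_nth = fps_binomial_compose_nth[where p = p and v = v and c = "complex_of_real c", OF v_low \<open>p \<ge> 1\<close>, folded H_def]
  have a_0: "a 0 = 1"
    using H_nth(1) by (simp add: a_def)
  have a_mid: "a n = c * e (n + d)" if "0 < n" "n < 2 * p" for n
    using that by (simp add: a_def H_nth(2) v_nth)
  have a_low: "a n = 0" if "0 < n" "n < p" for n
    using a_mid[of n] e[of "n + d"] that assms by simp
  have a_double: "a (2 * p) = c * e (2 * p + d) + c * (c - 1) / 2 * (e (p + d))\<^sup>2"
  proof -
    have "H $ (2 * p) = of_real (c * e (2 * p + d) + c * (c - 1) / 2 * (e (p + d))\<^sup>2)"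
      using \<open>p \<ge> 1\<close> by (simp add: H_nth(3) v_nth)
    then show ?thesis unfolding a_def by simp
  qed
  have "((\<lambda>x. (1 + x) powr of_real c) \<circ> V) has_fps_expansion H"
    unfolding H_def using v_low[of 0] \<open>p \<ge> 1\<close>
    by (intro has_fps_expansion_compose has_fps_expansion_binomial_complex V) simp
  then have radius: "fps_conv_radius H > 0"
    and eval: "\<forall>\<^sub>F z in nhds 0. eval_fps H z = (1 + V z) powr of_real c"
    by (auto simp: has_fps_expansion_def)
  have "\<forall>\<^sub>F z in nhds 0. z \<in> eball 0 (fps_conv_radius H)"
    using radius by (intro eventually_nhds_in_open) (auto simp: zero_ereal_def)
  with eval have "\<forall>\<^sub>F z in nhds 0. (\<lambda>n. H $ n * z ^ n) sums ((1 + V z) powr of_real c)"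
  proof eventually_elim
    case (elim z)
    then show ?case using sums_eval_fps[of z H] by (simp add: in_eball_iff)
  qed
  moreover have "filterlim complex_of_real (nhds 0) (at_right 0)"
    by (auto intro!: tendsto_eq_intros)
  ultimately have "\<forall>\<^sub>F h in at_right 0. (\<lambda>n. H $ n * of_real h ^ n) sums ((1 + V (of_real h)) powr of_real c)"
    by (rule eventually_compose_filterlim)
  with E_eq have a_sums: "\<forall>\<^sub>F h in at_right 0. (\<lambda>n. a n * h ^ n) sums G h"
  proof eventually_elim
    case (elim h)
    have "Ez (of_real h) = of_real (E h)"
      by (simp add: Ez_def E_def flip: exp_of_real)
    then have "1 + V (of_real h) = of_real (G h powr (1 / c))"
      using elim by (simp add: V_def)
    then have "(1 + V (of_real h)) powr of_real c = of_real (G h)"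
      using elim \<open>c > 0\<close> by (simp add: powr_of_real powr_powr)
    then have "(\<lambda>n. H $ n * of_real h ^ n) sums of_real (G h)"
      using elim by simp
    then have "(\<lambda>n. Re (H $ n * of_real h ^ n)) sums Re (of_real (G h))"
      by (rule sums_Re)
    then show ?case by (simp add: a_def flip: of_real_power)
  qed
  have expansion: "symbol_expansion w \<alpha> p r a"
    unfolding symbol_expansion_def using a_sums
  proof eventually_elim
    case (elim h)
    \<comment> \<open>Below order p only a 0 = 1 survives, the 1 subtracted in
      \<open>symbol_expansion\<close>.\<close>
    have "(\<Sum>n<p. a n * h ^ n) = (\<Sum>n\<in>{0}. a n * h ^ n)"
      using \<open>p \<ge> 1\<close> a_low by (intro sum.mono_neutral_right) auto
    with sums_split_initial_segment[OF elim, of p] show ?case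
      by (simp add: a_0 G_def add.commute)
  qed
  have R: "R_formula \<alpha> d lam N \<beta> m = c * e m" for m
    by (simp add: R_formula_def c_def e_def mult_ac)
  show ?thesis
  proof (intro conjI exI[of _ a] allI impI ballI)
    show "b l = a l" if "error_expansion s w \<alpha> p r M b" "l \<in> {p..M}" for M b l
      by (rule error_expansion_unique[OF \<open>\<alpha> > 0\<close> expansion that(1) summ that(2)])
    show "a (m - d) = R_formula \<alpha> d lam N \<beta> m" if "m \<in> {N..<N + p}" for m
      using a_mid[of "m - d"] that \<open>N = p + d\<close> \<open>p \<ge> 1\<close> unfolding R by auto
    have "a p = c * e (p + d)"
      using a_mid[of p] \<open>p \<ge> 1\<close> by simp
    moreover have "(\<alpha> - real d) / (2 * \<alpha>) = (c - 1) / (2 * c)"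
      using \<open>\<alpha> > 0\<close> \<open>d \<ge> 1\<close> by (simp add: c_def field_simps)
    moreover have "N + p - d = 2 * p" "N - d = p" "N + p = 2 * p + d"
      using \<open>N = p + d\<close> by auto
    \<comment> \<open>With x = e (p + d) and a p = c x, the quadratic binomial term becomes a
      multiple of the squared leading error coefficient.\<close>
    moreover have "c * (c - 1) / 2 * x\<^sup>2 = (c - 1) / (2 * c) * (c * x)\<^sup>2" for x
      using \<open>c > 0\<close> by (simp add: power2_eq_square)
    ultimately show "a (N + p - d) = R_formula \<alpha> d lam N \<beta> (N + p)
        + (\<alpha> - real d) / (2 * \<alpha>) * (a (N - d))\<^sup>2"
      using a_double unfolding R by (simp only:)
  qed (use beta expansion in auto)
qed

end
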